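(* Let $V_0$ be a real function of $r$ and $$H=-\frac{\hbar^2}{2}\nabla^2+V_0(r)+\frac{\hbar}{2r^2}(\vec\sigma_1+\vec\sigma_2,\vec L)+\frac{\hbar^2}{4r^2}(\vec\sigma_1,\vec\sigma_2).$$ Put $K=(\vec\sigma_1,\vec\sigma_2)$ and $$Y_P^5=\frac1r(\vec x,\vec\sigma_1\times\vec\sigma_2),\qquad Y_P^6=\frac1r(\vec\sigma_1,\vec x),\qquad Y_P^7=\frac1r(\vec\sigma_2-\vec\sigma_1,\vec x).$$ Then the operators $K,Y_P^5,Y_P^6,Y_P^7$ (which are integrals of motion of $H$) generate a polynomial symmetry algebra with commutation relations $$[K,Y_P^6]=2iY_P^5,\qquad [K,Y_P^5]=4iY_P^7,\qquad [K,Y_P^7]=-4iY_P^5,\qquad [Y_P^6,Y_P^7]=0,$$ $$[Y_P^6,Y_P^5]=2i\left(K-1+\frac{(Y_P^5)^2}{2}\right),\qquad [Y_P^7,Y_P^5]=-4i\left(K-1+\frac{(Y_P^5)^2}{2}\right).$$ Moreover $(Y_P^6)^2=1$, $(Y_P^7)^2=(Y_P^5)^2$, and the combination $$Y_P^7+2Y_P^6=\frac1r(\vec\sigma_1+\vec\sigma_2,\vec x)=\frac2r(\vec S,\vec x)$$ commutes with $K$, $Y_P^5$, $Y_P^6$ and $Y_P^7$.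
   Context: $\vec x\in\mathbb R^3\setminus\{0\}$, $r=|\vec x|$, $p_k=-i\hbar\,\partial/\partial x_k$ with $\hbar>0$, $\vec L=\vec x\times\vec p$, $(\cdot,\cdot)$ is the Euclidean inner product; $\vec\sigma$ is the vector of Pauli matrices, $\vec\sigma_1=\vec\sigma\otimes I_2$, $\vec\sigma_2=I_2\otimes\vec\sigma$, $\vec S=\frac12(\vec\sigma_1+\vec\sigma_2)$. Operators act on smooth $\mathbb C^4$-valued functions on $\mathbb R^3\setminus\{0\}$. An integral of motion is an operator commuting with $H$; a polynomial symmetry algebra is one generated by integrals of motion whose pairwise commutators are polynomials in the generators. *)

theory Defs
  imports "HOL-Analysis.Analysis" "HOL-Library.Function_Algebras"
begin

text \<open>
  Functions on \<open>\<real>\<^sup>3 - {0}\<close> with values in \<open>\<complex>\<^sup>4 = \<complex>\<^sup>2 \<otimes> \<complex>\<^sup>2\<close> are total functions whose value at the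
  origin is disregarded; the basis of \<open>\<complex>\<^sup>2 \<otimes> \<complex>\<^sup>2\<close> is indexed by pairs. Sums and differences of
  operators are the pointwise ones of \<^theory>\<open>HOL-Library.Function_Algebras\<close>, whereas products of
  operators are written with \<open>\<circ>\<close> and the unit operator is \<^const>\<open>id\<close> (the symbols \<open>*\<close> and \<open>1\<close> on
  functions would be pointwise).
\<close>

type_synonym spinor = "complex ^ (2 \<times> 2)"
type_synonym spinor_field = "real ^ 3 \<Rightarrow> spinor"
type_synonym operator = "spinor_field \<Rightarrow> spinor_field"

definition partial :: "3 \<Rightarrow> (real ^ 3 \<Rightarrow> 'b::real_normed_vector) \<Rightarrow> real ^ 3 \<Rightarrow> 'b" where
  "partial k f x = frechet_derivative f (at x) (axis k 1)"

primrec continuously_differentiable :: "nat \<Rightarrow> (real ^ 3 \<Rightarrow> 'b::real_normed_vector) \<Rightarrow> bool" where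
  "continuously_differentiable 0 f \<longleftrightarrow> continuous_on (- {0}) f"
| "continuously_differentiable (Suc n) f \<longleftrightarrow>
     f differentiable_on (- {0}) \<and> (\<forall>k. continuously_differentiable n (partial k f))"

definition smooth :: "(real ^ 3 \<Rightarrow> 'b::real_normed_vector) \<Rightarrow> bool" where
  "smooth f \<longleftrightarrow> (\<forall>n. continuously_differentiable n f)"

definition op_eq :: "operator \<Rightarrow> operator \<Rightarrow> bool"  (infix "\<doteq>" 50) where
  "A \<doteq> B \<longleftrightarrow> (\<forall>\<psi>. smooth \<psi> \<longrightarrow> (\<forall>x. x \<noteq> 0 \<longrightarrow> A \<psi> x = B \<psi> x))"

text \<open>Linear operators on the space of smooth functions on \<open>\<real>\<^sup>3 - {0}\<close>; the second conjunct says
  that the operator does not depend on the value of its argument at the origin.\<close>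

definition smooth_operator :: "operator \<Rightarrow> bool" where
  "smooth_operator A \<longleftrightarrow>
     (\<forall>\<psi>. smooth \<psi> \<longrightarrow> smooth (A \<psi>)) \<and>
     (\<forall>\<phi> \<psi>. smooth \<phi> \<longrightarrow> smooth \<psi> \<longrightarrow> (\<forall>x. x \<noteq> 0 \<longrightarrow> \<phi> x = \<psi> x) \<longrightarrow>
        (\<forall>x. x \<noteq> 0 \<longrightarrow> A \<phi> x = A \<psi> x)) \<and>
     (\<forall>\<phi> \<psi> a b. smooth \<phi> \<longrightarrow> smooth \<psi> \<longrightarrow>
        (\<forall>x. x \<noteq> 0 \<longrightarrow> A (\<lambda>y. a *s \<phi> y + b *s \<psi> y) x = a *s A \<phi> x + b *s A \<psi> x))"

definition commutator :: "operator \<Rightarrow> operator \<Rightarrow> operator" where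
  "commutator A B = (A \<circ> B) - (B \<circ> A)"

definition mult_op :: "(real ^ 3 \<Rightarrow> complex) \<Rightarrow> operator" where
  "mult_op f \<psi> x = f x *s \<psi> x"

abbreviation scale_op :: "complex \<Rightarrow> operator \<Rightarrow> operator"  (infixr "\<cdot>\<^sub>o" 75) where
  "c \<cdot>\<^sub>o A \<equiv> mult_op (\<lambda>_. c) \<circ> A"

definition matrix_op :: "complex ^ (2 \<times> 2) ^ (2 \<times> 2) \<Rightarrow> operator" where
  "matrix_op M \<psi> x = M *v \<psi> x"

definition op_inner :: "(3 \<Rightarrow> operator) \<Rightarrow> (3 \<Rightarrow> operator) \<Rightarrow> operator" where
  "op_inner A B = (\<Sum>k\<in>UNIV. A k \<circ> B k)"

text \<open>Arithmetic in the index type \<open>3\<close> is modulo 3, so \<open>k\<close>, \<open>k + 1\<close>, \<open>k + 2\<close> is always a cyclic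
  permutation of the three indices.\<close>

definition op_cross :: "(3 \<Rightarrow> operator) \<Rightarrow> (3 \<Rightarrow> operator) \<Rightarrow> 3 \<Rightarrow> operator" where
  "op_cross A B k = (A (k + 1) \<circ> B (k + 2)) - (A (k + 2) \<circ> B (k + 1))"

definition position :: "3 \<Rightarrow> operator" where
  "position k = mult_op (\<lambda>x. of_real (x $ k))"

definition inv_radius :: operator where
  "inv_radius = mult_op (\<lambda>x. of_real (1 / norm x))"

definition momentum :: "real \<Rightarrow> 3 \<Rightarrow> operator" where
  "momentum hbar k = (- \<i> * of_real hbar) \<cdot>\<^sub>o partial k"

definition angular_momentum :: "real \<Rightarrow> 3 \<Rightarrow> operator" where
  "angular_momentum hbar = op_cross position (momentum hbar)"

definition laplacian :: operator where
  "laplacian = op_inner partial partial"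

definition pauli :: "complex ^ 2 ^ 2 ^ 3" where
  "pauli = vector [vector [vector [0, 1], vector [1, 0]],
                   vector [vector [0, - \<i>], vector [\<i>, 0]],
                   vector [vector [1, 0], vector [0, - 1]]]"

definition kronecker :: "complex ^ 2 ^ 2 \<Rightarrow> complex ^ 2 ^ 2 \<Rightarrow> complex ^ (2 \<times> 2) ^ (2 \<times> 2)" where
  "kronecker A B = (\<chi> i j. A $ fst i $ fst j * B $ snd i $ snd j)"

definition sigma1 :: "3 \<Rightarrow> operator" where
  "sigma1 k = matrix_op (kronecker (pauli $ k) (mat 1))"

definition sigma2 :: "3 \<Rightarrow> operator" where
  "sigma2 k = matrix_op (kronecker (mat 1) (pauli $ k))"

definition spin :: "3 \<Rightarrow> operator" where
  "spin k = (1 / 2) \<cdot>\<^sub>o (sigma1 k + sigma2 k)"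

definition hamiltonian :: "real \<Rightarrow> (real \<Rightarrow> real) \<Rightarrow> operator" where
  "hamiltonian hbar V\<^sub>0 =
     of_real (- (hbar\<^sup>2 / 2)) \<cdot>\<^sub>o laplacian
     + mult_op (\<lambda>x. of_real (V\<^sub>0 (norm x)))
     + (mult_op (\<lambda>x. of_real (hbar / (2 * (norm x)\<^sup>2)))
          \<circ> op_inner (sigma1 + sigma2) (angular_momentum hbar))
     + (mult_op (\<lambda>x. of_real (hbar\<^sup>2 / (4 * (norm x)\<^sup>2))) \<circ> op_inner sigma1 sigma2)"

definition op_K :: operator where
  "op_K = op_inner sigma1 sigma2"

definition Y5 :: operator where
  "Y5 = inv_radius \<circ> op_inner position (op_cross sigma1 sigma2)"

definition Y6 :: operator where
  "Y6 = inv_radius \<circ> op_inner sigma1 position"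

definition Y7 :: operator where
  "Y7 = inv_radius \<circ> op_inner (sigma2 - sigma1) position"

text \<open>\<open>H\<close> is not required to be a \<^const>\<open>smooth_operator\<close>, since the potential need not be smooth.\<close>

definition integral_of_motion :: "operator \<Rightarrow> operator \<Rightarrow> bool" where
  "integral_of_motion H A \<longleftrightarrow> smooth_operator A \<and> commutator H A \<doteq> 0"

text \<open>Noncommutative polynomials with complex coefficients in the operators of \<open>G\<close>.\<close>

inductive_set polynomials_in :: "operator set \<Rightarrow> operator set" for G where
  const: "c \<cdot>\<^sub>o id \<in> polynomials_in G"
| gen: "A \<in> G \<Longrightarrow> A \<in> polynomials_in G"
| add: "A \<in> polynomials_in G \<Longrightarrow> B \<in> polynomials_in G \<Longrightarrow> A + B \<in> polynomials_in G"
| comp: "A \<in> polynomials_in G \<Longrightarrow> B \<in> polynomials_in G \<Longrightarrow> A \<circ> B \<in> polynomials_in G"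

definition generates_polynomial_symmetry_algebra :: "operator \<Rightarrow> operator set \<Rightarrow> bool" where
  "generates_polynomial_symmetry_algebra H G \<longleftrightarrow>
     finite G \<and> (\<forall>A\<in>G. integral_of_motion H A) \<and>
     (\<forall>A\<in>G. \<forall>B\<in>G. \<exists>P\<in>polynomials_in G. commutator A B \<doteq> P)"

end

theory Submission imports Defs begin

text \<open>
  All the operators except the Hamiltonian act as multiplication by a field of \<open>4 \<times> 4\<close> matrices, so the
  commutation relations are pointwise identities between combinations of the products
  \<open>\<sigma>\<^sub>a \<otimes> \<sigma>\<^sub>b\<close>, and the multiplication table of the Pauli matrices together with \<open>(n, n) = 1\<close> for
  \<open>n = x / r\<close> decides them. The commutator of the Hamiltonian with a matrix field is a first order
  differential operator, in which the potential cancels. Each of the three operators \<open>Y\<close> is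
  multiplication by \<open>(n, A)\<close> for a constant vector \<open>A\<close> of matrices; since
  \<open>\<partial>\<^sub>j n = (e\<^sub>j - n\<^sub>j n) / r\<close> and \<open>\<Delta>n = - 2 n / r\<^sup>2\<close>, the coefficients of this commutator vanish by
  algebraic relations between \<open>A\<close>, the total spin and \<open>(\<sigma>\<^sub>1, \<sigma>\<^sub>2)\<close>.
\<close>

section \<open>Smooth fields on the punctured space\<close>

lemma open_punctured: "open (- {0 :: 'a::{t1_space, zero}})"
  by (rule open_Compl) simp

lemma partial_eqI:
  assumes "(f has_derivative f') (at x)"
  shows "partial k f x = f' (axis k 1)"
  using frechet_derivative_at[OF assms] by (simp add: partial_def)

text \<open>Values at the origin are arbitrary, so formulas are known off it only; since the
  punctured space is open, they may still be differentiated there.\<close>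

lemma partial_cong:
  assumes "\<And>y. y \<noteq> 0 \<Longrightarrow> f y = g y" "f differentiable at x" "x \<noteq> 0"
  shows "partial k f x = partial k g x"
  using frechet_derivative_transform_within_open[OF assms(2) open_punctured _ assms(1)] assms(3)
  by (simp add: partial_def)

lemma differentiable_on_punctured:
  "f differentiable_on (- {0}) \<longleftrightarrow> (\<forall>x. x \<noteq> 0 \<longrightarrow> f differentiable at x)"
  by (auto simp: differentiable_on_def at_within_open[OF _ open_punctured])

text \<open>Lets an induction on the order replace \<open>partial k f\<close> by a formula that
  holds off the origin only.\<close>

lemma continuously_differentiable_cong:
  assumes "\<And>x. x \<noteq> 0 \<Longrightarrow> f x = g x"
  shows "continuously_differentiable n f \<Longrightarrow> continuously_differentiable n g"
  using assms
proof (induction n arbitrary: f g)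
  case 0
  then show ?case
    using continuous_on_cong[of "- {0}" "- {0}" f g] by simp
next
  case (Suc n)
  have "g differentiable_on (- {0})"
    unfolding differentiable_on_punctured
  proof (intro allI impI)
    fix x :: "real^3" assume "x \<noteq> 0"
    then obtain f' where "(f has_derivative f') (at x)"
      using Suc.prems by (auto simp: differentiable_on_punctured differentiable_def)
    then have "(g has_derivative f') (at x)"
      by (rule has_derivative_transform_within_open[OF _ open_punctured])
         (use Suc.prems(2) \<open>x \<noteq> 0\<close> in simp_all)
    then show "g differentiable at x" by (rule differentiableI)
  qed
  moreover have "continuously_differentiable n (partial k g)" for k
  proof (rule Suc.IH)
    show "continuously_differentiable n (partial k f)"
      using Suc.prems by simp
    show "partial k f x = partial k g x" if "x \<noteq> 0" for x
      using Suc.prems that by (intro partial_cong) (auto simp: differentiable_on_punctured)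
  qed
  ultimately show ?case by simp
qed

lemma continuously_differentiable_Suc_imp:
  "continuously_differentiable (Suc n) f \<Longrightarrow> continuously_differentiable n f"
proof (induction n arbitrary: f)
  case 0
  then show ?case by (simp add: differentiable_imp_continuous_on)
next
  case (Suc n)
  then show ?case by simp
qed

lemma partial_add:
  assumes "f differentiable at x" "g differentiable at x"
  shows "partial k (\<lambda>y. f y + g y) x = partial k f x + partial k g x"
  using partial_eqI[OF has_derivative_add[OF assms[unfolded frechet_derivative_works]], of k]
  by (simp add: partial_def)

lemma partial_bounded_bilinear:
  assumes "bounded_bilinear pr" "f differentiable at x" "g differentiable at x"
  shows "partial k (\<lambda>y. pr (f y) (g y)) x = pr (f x) (partial k g x) + pr (partial k f x) (g x)"
  using partial_eqI[OF bounded_bilinear.FDERIV[OF assms(1) assms(2,3)[unfolded frechet_derivative_works]], of k]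
  by (simp add: partial_def)

lemma continuously_differentiable_add:
  assumes "continuously_differentiable n f" "continuously_differentiable n g"
  shows "continuously_differentiable n (\<lambda>x. f x + g x)"
  using assms
proof (induction n arbitrary: f g)
  case 0
  then show ?case by (simp add: continuous_on_add)
next
  case (Suc n)
  have "continuously_differentiable n (partial k (\<lambda>x. f x + g x))" for k
  proof (rule continuously_differentiable_cong)
    show "continuously_differentiable n (\<lambda>x. partial k f x + partial k g x)"
      using Suc.prems by (intro Suc.IH) simp_all
  qed (use Suc.prems in \<open>simp add: partial_add differentiable_on_punctured\<close>)
  with Suc.prems show ?case by (simp add: differentiable_on_punctured)
qed

text \<open>The product rule keeps undifferentiated factors, which
  \<open>continuously_differentiable_Suc_imp\<close> lowers to order \<open>n\<close>. An arbitrary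
  bounded bilinear \<open>pr\<close> covers real products, scaling and matrices acting on vectors at
  once.\<close>

lemma continuously_differentiable_bounded_bilinear:
  assumes "bounded_bilinear pr"
    and "continuously_differentiable n f" "continuously_differentiable n g"
  shows "continuously_differentiable n (\<lambda>x. pr (f x) (g x))"
  using assms(2,3)
proof (induction n arbitrary: f g)
  case 0
  then show ?case using bounded_bilinear.continuous_on[OF assms(1)] by auto
next
  case (Suc n)
  have diff: "f differentiable at x" "g differentiable at x" if "x \<noteq> 0" for x
    using Suc.prems that by (auto simp: differentiable_on_punctured)
  have "(\<lambda>x. pr (f x) (g x)) differentiable at x" if "x \<noteq> 0" for x
    using bounded_bilinear.FDERIV[OF assms(1) diff[OF that, unfolded frechet_derivative_works]]
    by (rule differentiableI)
  moreover have "continuously_differentiable n (partial k (\<lambda>x. pr (f x) (g x)))" for k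
  proof (rule continuously_differentiable_cong)
    show "continuously_differentiable n (\<lambda>x. pr (f x) (partial k g x) + pr (partial k f x) (g x))"
      using Suc.prems Suc.prems[THEN continuously_differentiable_Suc_imp]
      by (intro continuously_differentiable_add Suc.IH) simp_all
  qed (simp add: partial_bounded_bilinear[OF assms(1)] diff)
  ultimately show ?case by (simp add: differentiable_on_punctured)
qed

lemma smooth_differentiable: "smooth f \<Longrightarrow> x \<noteq> 0 \<Longrightarrow> f differentiable at x"
  using continuously_differentiable.simps(2)[of 0 f] by (simp add: smooth_def differentiable_on_punctured)

lemma smooth_partial: "smooth f \<Longrightarrow> smooth (partial k f)"
  unfolding smooth_def by (metis continuously_differentiable.simps(2))

lemma smooth_add: "smooth f \<Longrightarrow> smooth g \<Longrightarrow> smooth (\<lambda>x. f x + g x)"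
  by (simp add: smooth_def continuously_differentiable_add)

lemma smooth_bounded_bilinear:
  "bounded_bilinear pr \<Longrightarrow> smooth f \<Longrightarrow> smooth g \<Longrightarrow> smooth (\<lambda>x. pr (f x) (g x))"
  by (simp add: smooth_def continuously_differentiable_bounded_bilinear)

lemma continuously_differentiable_const: "continuously_differentiable n (\<lambda>_. c)"
proof (induction n arbitrary: c)
  case (Suc n)
  have "partial k (\<lambda>_. c) = (\<lambda>_. 0)" for k
    by (simp add: partial_def fun_eq_iff)
  with Suc show ?case by simp
qed simp

lemma smooth_const: "smooth (\<lambda>_. c)"
  by (simp add: smooth_def continuously_differentiable_const)

lemma smooth_sum: "(\<And>i. i \<in> A \<Longrightarrow> smooth (f i)) \<Longrightarrow> smooth (\<lambda>x. \<Sum>i\<in>A. f i x)"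
  by (induction A rule: infinite_finite_induct) (auto simp: smooth_const smooth_add)

lemma smooth_component: "smooth (\<lambda>x::real^3. x $ k)"
proof -
  have "partial j (\<lambda>x::real^3. x $ k) = (\<lambda>_. axis j 1 $ k)" for j
    by (rule ext, rule partial_eqI) (rule bounded_linear_imp_has_derivative[OF bounded_linear_vec_nth])
  moreover have "(\<lambda>x::real^3. x $ k) differentiable_on (- {0})"
    by (simp add: bounded_linear_vec_nth bounded_linear_imp_differentiable_on)
  moreover have "continuously_differentiable 0 (\<lambda>x::real^3. x $ k)"
    by (simp add: continuous_on_component)
  ultimately have "continuously_differentiable n (\<lambda>x::real^3. x $ k)" for n
    by (cases n) (simp_all add: continuously_differentiable_const)
  then show ?thesis by (simp add: smooth_def)
qed

section \<open>The inverse norm\<close>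

lemma has_derivative_inverse_norm:
  fixes x :: "'a::real_inner"
  assumes "x \<noteq> 0"
  shows "((\<lambda>y. 1 / norm y) has_derivative (\<lambda>h. - (x \<bullet> h) * (1 / norm x) ^ 3)) (at x)"
proof -
  have "((\<lambda>y. inverse (norm y)) has_derivative
      (\<lambda>h. - (inverse (norm x) * (h \<bullet> sgn x) * inverse (norm x)))) (at x)"
    using assms by (intro Deriv.has_derivative_inverse has_derivative_norm) auto
  then show ?thesis
    unfolding inverse_eq_divide
    by (rule has_derivative_eq_rhs) (simp add: sgn_div_norm fun_eq_iff inner_commute power3_eq_cube divide_inverse)
qed

text \<open>The partial derivatives of 1/r are -x_k (1/r)^3, polynomials in the coordinates and 1/r
  itself, so the induction on the order closes.\<close>

lemma smooth_inverse_norm: "smooth (\<lambda>x. 1 / norm x)"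
proof -
  let ?u = "\<lambda>x::real^3. 1 / norm x"
  have "continuously_differentiable n ?u" for n
  proof (induction n)
    case 0
    show ?case by (simp add: continuous_on_divide continuous_on_norm)
  next
    case (Suc n)
    have "?u differentiable_on (- {0})"
      unfolding differentiable_on_punctured
      by (intro allI impI) (erule differentiableI[OF has_derivative_inverse_norm])
    moreover have "continuously_differentiable n (partial k ?u)" for k
    proof (rule continuously_differentiable_cong)
      have "continuously_differentiable n (\<lambda>x::real^3. x $ k)"
        using smooth_component by (simp add: smooth_def)
      then show "continuously_differentiable n (\<lambda>x. (- 1) * (x $ k * (?u x * (?u x * ?u x))))"
        by (intro continuously_differentiable_bounded_bilinear[OF bounded_bilinear_mult]
              continuously_differentiable_const Suc.IH)
      show "(- 1) * (x $ k * (?u x * (?u x * ?u x))) = partial k ?u x" if "x \<noteq> 0" for x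
        by (subst partial_eqI[OF has_derivative_inverse_norm[OF that]])
           (simp add: inner_axis power3_eq_cube)
    qed
    ultimately show ?case by simp
  qed
  then show ?thesis by (simp add: smooth_def)
qed

lemma partial_bounded_linear:
  assumes "bounded_linear h" "f differentiable at x"
  shows "partial k (\<lambda>y. h (f y)) x = h (partial k f x)"
  using partial_eqI[OF bounded_linear.has_derivative[OF assms(1) assms(2)[unfolded frechet_derivative_works]], of k]
  by (simp add: partial_def)

lemma smooth_bounded_linear:
  assumes "bounded_linear h" "smooth f"
  shows "smooth (\<lambda>x. h (f x))"
proof -
  \<comment> \<open>Scaling by a constant field 1 makes the linear map an instance of the bilinear
    case and saves a second induction.\<close>
  have "bounded_bilinear (\<lambda>c v. c *\<^sub>R h v)"
    using bounded_bilinear.comp[OF bounded_bilinear_scaleR bounded_linear_ident assms(1)] .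
  from smooth_bounded_bilinear[OF this smooth_const[of 1] assms(2)] show ?thesis by simp
qed

lemma smooth_diff: "smooth f \<Longrightarrow> smooth g \<Longrightarrow> smooth (\<lambda>x. f x - g x)"
  using smooth_add[OF _ smooth_bounded_linear[OF bounded_linear_minus[OF bounded_linear_ident]], of f g] by simp

lemma partial_const: "partial k (\<lambda>_. c) x = 0"
  by (simp add: partial_def)

lemma partial_diff:
  assumes "f differentiable at x" "g differentiable at x"
  shows "partial k (\<lambda>y. f y - g y) x = partial k f x - partial k g x"
  using partial_eqI[OF has_derivative_diff[OF assms[unfolded frechet_derivative_works]], of k]
  by (simp add: partial_def)

section \<open>Derivatives of the unit vector field n = \<open>sgn x\<close>\<close>

lemma sgn_conv_norm: "sgn x = (1 / norm x) *\<^sub>R x"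
  by (simp add: sgn_div_norm divide_inverse)

lemma smooth_ident: "smooth (\<lambda>x. x)"
proof -
  have "smooth (\<lambda>x::real^3. \<Sum>k\<in>UNIV. x $ k *\<^sub>R (axis k 1 :: real^3))"
    by (intro smooth_sum smooth_bounded_bilinear[OF bounded_bilinear_scaleR] smooth_component smooth_const)
  also have "(\<lambda>x::real^3. \<Sum>k\<in>UNIV. x $ k *\<^sub>R (axis k 1 :: real^3)) = (\<lambda>x. x)"
    using basis_expansion[where 'a = real and 'n = 3] by (simp add: scalar_mult_eq_scaleR)
  finally show ?thesis .
qed

lemma smooth_sgn: "smooth (sgn :: real^3 \<Rightarrow> _)"
  unfolding sgn_conv_norm[abs_def]
  by (intro smooth_bounded_bilinear[OF bounded_bilinear_scaleR] smooth_inverse_norm smooth_ident)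

lemma sum_sgn_squares:
  fixes x :: "real^3"
  assumes "x \<noteq> 0"
  shows "(\<Sum>k\<in>UNIV. (sgn x $ k)\<^sup>2) = 1"
  using norm_sgn[of x] assms by (simp add: norm_vec_def L2_set_def real_sqrt_eq_1_iff)

lemma partial_inverse_norm:
  "x \<noteq> 0 \<Longrightarrow> partial j (\<lambda>y. 1 / norm y) x = - (sgn x $ j) * (1 / norm x)\<^sup>2"
  by (subst partial_eqI[OF has_derivative_inverse_norm])
     (simp_all add: inner_axis sgn_conv_norm power3_eq_cube power2_eq_square)

text \<open>The product rule for (1/r) x: a displacement changes the direction only by its part
  orthogonal to n, divided by r.\<close>

lemma partial_sgn:
  assumes "x \<noteq> 0"
  shows "partial j sgn x = (1 / norm x) *\<^sub>R (axis j 1 - sgn x $ j *\<^sub>R sgn x)"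
proof -
  have "partial j (\<lambda>y. (1 / norm y) *\<^sub>R y) x =
      (1 / norm x) *\<^sub>R partial j (\<lambda>y. y) x + partial j (\<lambda>y. 1 / norm y) x *\<^sub>R x"
    using assms by (intro partial_bounded_bilinear[OF bounded_bilinear_scaleR] smooth_differentiable
        smooth_inverse_norm smooth_ident)
  moreover have "partial j (\<lambda>y::real^3. y) x = axis j 1"
    by (rule partial_eqI) simp
  ultimately show ?thesis
    by (simp add: partial_inverse_norm assms sgn_conv_norm[abs_def] scaleR_diff_right power2_eq_square)
qed

text \<open>The components of n are spherical harmonics of degree 1, with eigenvalue -2 on the unit
  sphere.\<close>

lemma laplacian_sgn:
  fixes x :: "real^3"
  assumes "x \<noteq> 0"
  shows "(\<Sum>j\<in>UNIV. partial j (partial j sgn) x) = - (2 / (norm x)\<^sup>2) *\<^sub>R sgn x"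
proof -
  let ?n = "sgn x"
  have *: "partial j (partial j sgn) x =
      (1 / norm x)\<^sup>2 *\<^sub>R ((3 * (?n $ j)\<^sup>2 - 1) *\<^sub>R ?n - (2 * ?n $ j) *\<^sub>R axis j 1)" for j
  proof -
    have nth: "partial j (\<lambda>y. sgn y $ j) x = partial j sgn x $ j"
      using assms by (intro partial_bounded_linear bounded_linear_vec_nth smooth_differentiable smooth_sgn)
    have smj: "smooth (\<lambda>y::real^3. sgn y $ j)"
      by (rule smooth_bounded_linear[OF bounded_linear_vec_nth smooth_sgn])
    have smf: "smooth (\<lambda>y::real^3. axis j 1 - sgn y $ j *\<^sub>R sgn y)"
      by (intro smooth_diff smooth_const smooth_bounded_bilinear[OF bounded_bilinear_scaleR] smj smooth_sgn)
    have "partial j (\<lambda>y. sgn y $ j *\<^sub>R sgn y) x = ?n $ j *\<^sub>R partial j sgn x + (partial j sgn x $ j) *\<^sub>R ?n"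
      unfolding nth[symmetric] using assms
      by (intro partial_bounded_bilinear[OF bounded_bilinear_scaleR] smooth_differentiable smj smooth_sgn)
    then have f: "partial j (\<lambda>y. axis j 1 - sgn y $ j *\<^sub>R sgn y) x =
        - (?n $ j *\<^sub>R partial j sgn x + (partial j sgn x $ j) *\<^sub>R ?n)"
      using partial_diff[of "\<lambda>_. axis j 1" x "\<lambda>y. sgn y $ j *\<^sub>R sgn y" j] assms
      by (simp add: smooth_differentiable smooth_bounded_bilinear[OF bounded_bilinear_scaleR] smj smooth_sgn
          partial_const)
    have "partial j (partial j sgn) x =
        partial j (\<lambda>y. (1 / norm y) *\<^sub>R (axis j 1 - sgn y $ j *\<^sub>R sgn y)) x"
      using assms by (intro partial_cong partial_sgn smooth_differentiable smooth_partial smooth_sgn)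
    also have "\<dots> = (1 / norm x) *\<^sub>R partial j (\<lambda>y. axis j 1 - sgn y $ j *\<^sub>R sgn y) x
        + partial j (\<lambda>y. 1 / norm y) x *\<^sub>R (axis j 1 - ?n $ j *\<^sub>R ?n)"
      using assms by (intro partial_bounded_bilinear[OF bounded_bilinear_scaleR] smooth_differentiable
          smooth_inverse_norm smf)
    also have "\<dots> = (1 / norm x)\<^sup>2 *\<^sub>R ((3 * (?n $ j)\<^sup>2 - 1) *\<^sub>R ?n - (2 * ?n $ j) *\<^sub>R axis j 1)"
      unfolding f partial_inverse_norm[OF assms] partial_sgn[OF assms]
      by (simp add: vec_eq_iff power2_eq_square algebra_simps)
    finally show ?thesis .
  qed
  \<comment> \<open>As the squares of the components sum to 1, the coefficient of n becomes 3 - 3 -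
    2 = -2.\<close>
  have "(\<Sum>j\<in>UNIV. partial j (partial j sgn) x) = (1 / norm x)\<^sup>2 *\<^sub>R
      ((3 * (\<Sum>j\<in>UNIV. (?n $ j)\<^sup>2) - 3) *\<^sub>R ?n - 2 *\<^sub>R (\<Sum>j\<in>UNIV. ?n $ j *\<^sub>R axis j 1))"
    unfolding * by (simp add: sum_3 vec_eq_iff algebra_simps)
  also have "(\<Sum>j\<in>UNIV. ?n $ j *\<^sub>R axis j 1) = ?n"
    using basis_expansion[of ?n] by (simp add: scalar_mult_eq_scaleR)
  finally show ?thesis
    by (simp add: sum_sgn_squares assms power_divide)
qed

section \<open>Matrix fields as operators\<close>

type_synonym spin_matrix = "complex ^ (2 \<times> 2) ^ (2 \<times> 2)"

section \<open>Algebra of matrices and vectors\<close>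

lemma scaleR_matrix_mult_vector:
  fixes A :: "'a::real_algebra_1 ^ 'n ^ 'm"
  shows "(c *\<^sub>R A) *v v = c *\<^sub>R (A *v v)"
  by (simp add: vec_eq_iff matrix_vector_mult_def scaleR_sum_right)

lemma matrix_vector_mult_scaleR_right:
  fixes A :: "'a::real_algebra_1 ^ 'n ^ 'm"
  shows "A *v (c *\<^sub>R v) = c *\<^sub>R (A *v v)"
  by (simp add: vec_eq_iff matrix_vector_mult_def scaleR_sum_right)

text \<open>In finite dimension every bilinear map is bounded; this opens the product rule to matrix
  fields acting on spinors.\<close>

lemma bounded_bilinear_matrix_vector_mult:
  "bounded_bilinear ((*v) :: 'a::{euclidean_space, real_algebra_1} ^ 'n ^ 'm \<Rightarrow> _)"
  unfolding bilinear_conv_bounded_bilinear[symmetric] bilinear_def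
  by (auto intro!: linearI simp: matrix_vector_mult_add_rdistrib scaleR_matrix_mult_vector)

lemma of_real_vector_smult: "(of_real c :: 'a::real_algebra_1) *s v = c *\<^sub>R v"
  unfolding vec_eq_iff vector_scaleR_component vector_smult_component
  by (simp add: scaleR_conv_of_real)

lemma matrix_sub_ldistrib: "(A :: 'a::ring_1 ^ 'n ^ 'm) ** (B - C) = A ** B - A ** C"
  by (simp add: matrix_matrix_mult_def vec_eq_iff sum_subtractf right_diff_distrib)

lemma matrix_sub_rdistrib: "((A :: 'a::ring_1 ^ 'n ^ 'm) - B) ** C = A ** C - B ** C"
  by (simp add: matrix_matrix_mult_def vec_eq_iff sum_subtractf left_diff_distrib)

text \<open>Complex coefficients of matrices are carried by factors \<open>mat c\<close>, as
  \<open>*\<^sub>R\<close> gives real ones only; acting on a vector they become scalars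
  again.\<close>

lemma mat_vector_mult: "(mat c :: 'a::semiring_1 ^ 'n ^ 'n) *v v = c *s v"
  by (simp add: vec_eq_iff matrix_vector_mult_def mat_def if_distrib[where f = "\<lambda>y. y * _"]
      sum.delta cong: if_cong)

lemma mat_mult_component: "((mat c :: 'a::semiring_1 ^ 'n ^ 'n) ** A) $ i $ j = c * A $ i $ j"
  by (simp add: matrix_matrix_mult_def mat_def if_distrib[where f = "\<lambda>y. y * _"] cong: if_cong)

lemma matrix_mult_scaleR_right:
  "(A :: 'a::real_algebra_1 ^ 'n ^ 'm) ** (c *\<^sub>R B) = c *\<^sub>R (A ** B)"
  by (simp add: matrix_matrix_mult_def vec_eq_iff scaleR_sum_right)

lemma matrix_mult_scaleR_left:
  "(c *\<^sub>R (A :: 'a::real_algebra_1 ^ 'n ^ 'm)) ** B = c *\<^sub>R (A ** B)"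
  by (simp add: matrix_matrix_mult_def vec_eq_iff scaleR_sum_right)

lemma matrix_add_rdistrib: "((A :: 'a::semiring_1 ^ 'n ^ 'm) + B) ** C = A ** C + B ** C"
  by (simp add: matrix_matrix_mult_def vec_eq_iff sum.distrib distrib_right)

section \<open>Operators of multiplication by a matrix field\<close>

definition matrix_commutator :: "'a::ring_1 ^ 'n ^ 'n \<Rightarrow> 'a ^ 'n ^ 'n \<Rightarrow> 'a ^ 'n ^ 'n" where
  "matrix_commutator A B = A ** B - B ** A"

definition field_op :: "(real ^ 3 \<Rightarrow> spin_matrix) \<Rightarrow> operator" where
  "field_op M \<psi> x = M x *v \<psi> x"

lemma op_eq_field_op:
  assumes "\<And>x. x \<noteq> 0 \<Longrightarrow> M x = N x"
  shows "field_op M \<doteq> field_op N"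
  using assms by (simp add: op_eq_def field_op_def)

lemma field_op_comp: "field_op M \<circ> field_op N = field_op (\<lambda>x. M x ** N x)"
  by (simp add: fun_eq_iff field_op_def matrix_vector_mul_assoc)

lemma field_op_add: "field_op M + field_op N = field_op (\<lambda>x. M x + N x)"
  by (simp add: fun_eq_iff field_op_def matrix_vector_mult_add_rdistrib)

lemma field_op_diff: "field_op M - field_op N = field_op (\<lambda>x. M x - N x)"
  by (simp add: fun_eq_iff field_op_def matrix_vector_mult_diff_rdistrib)

lemma scale_field_op: "c \<cdot>\<^sub>o field_op M = field_op (\<lambda>x. mat c ** M x)"
  by (simp add: fun_eq_iff field_op_def mult_op_def matrix_vector_mul_assoc[symmetric] mat_vector_mult)

lemma id_field_op: "id = field_op (\<lambda>_. mat 1)"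
  by (simp add: fun_eq_iff field_op_def)

lemma zero_field_op: "0 = field_op (\<lambda>_. 0)"
  by (simp add: fun_eq_iff field_op_def)

lemma commutator_field_op:
  "commutator (field_op M) (field_op N) = field_op (\<lambda>x. matrix_commutator (M x) (N x))"
  by (simp add: commutator_def field_op_comp field_op_diff matrix_commutator_def)

lemma smooth_field_op: "smooth M \<Longrightarrow> smooth \<psi> \<Longrightarrow> smooth (field_op M \<psi>)"
  using smooth_bounded_bilinear[OF bounded_bilinear_matrix_vector_mult]
  by (simp add: field_op_def[abs_def])

lemma smooth_operator_field_op: "smooth M \<Longrightarrow> smooth_operator (field_op M)"
  unfolding smooth_operator_def
  by (simp add: smooth_field_op) (simp add: field_op_def matrix_vector_right_distrib vector_scalar_commute)

lemma partial_field_op: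
  assumes "smooth M" "smooth \<psi>" "x \<noteq> 0"
  shows "partial j (field_op M \<psi>) x = field_op M (partial j \<psi>) x + field_op (partial j M) \<psi> x"
  using partial_bounded_bilinear[OF bounded_bilinear_matrix_vector_mult, of M x \<psi> j] assms
  by (simp add: field_op_def[abs_def] smooth_differentiable)

text \<open>The product rule is applied twice, through \<open>partial_cong\<close> as it holds off
  the origin only. The last two terms are what survives in the commutator of the Laplacian with the
  field.\<close>

lemma partial_partial_field_op:
  assumes "smooth M" "smooth \<psi>" "x \<noteq> 0"
  shows "partial j (partial j (field_op M \<psi>)) x =
    field_op M (partial j (partial j \<psi>)) x + 2 *\<^sub>R field_op (partial j M) (partial j \<psi>) x
      + field_op (partial j (partial j M)) \<psi> x"
proof -
  note sm = assms(1,2) smooth_partial smooth_field_op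
  have "partial j (partial j (field_op M \<psi>)) x =
      partial j (\<lambda>y. field_op M (partial j \<psi>) y + field_op (partial j M) \<psi> y) x"
    by (rule partial_cong) (simp_all add: partial_field_op assms smooth_differentiable sm)
  also have "\<dots> = partial j (field_op M (partial j \<psi>)) x + partial j (field_op (partial j M) \<psi>) x"
    by (rule partial_add) (simp_all add: assms smooth_differentiable sm)
  finally show ?thesis
    by (simp add: partial_field_op sm assms scaleR_2)
qed

section \<open>Spin matrices on the tensor product\<close>

definition spin1 :: "3 \<Rightarrow> spin_matrix" where
  "spin1 k = kronecker (pauli $ k) (mat 1)"

definition spin2 :: "3 \<Rightarrow> spin_matrix" where
  "spin2 k = kronecker (mat 1) (pauli $ k)"

text \<open>This is twice the matrix of \<open>spin\<close>, whence the factors 2 in its commutators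
  below.\<close>

definition total_spin :: "3 \<Rightarrow> spin_matrix" where
  "total_spin k = spin1 k + spin2 k"

definition spin_coupling :: spin_matrix where
  "spin_coupling = (\<Sum>k\<in>UNIV. spin1 k ** spin2 k)"

definition spin_cross :: "3 \<Rightarrow> spin_matrix" where
  "spin_cross k = spin1 (k + 1) ** spin2 (k + 2) - spin1 (k + 2) ** spin2 (k + 1)"

definition along :: "real ^ 3 \<Rightarrow> (3 \<Rightarrow> spin_matrix) \<Rightarrow> spin_matrix" where
  "along n A = (\<Sum>k\<in>UNIV. n $ k *\<^sub>R A k)"

lemma sum_prod_2: "(\<Sum>p\<in>UNIV. f (p::2 \<times> 2)) = f (1, 1) + f (1, 2) + f (2, 1) + f (2, 2)"
proof -
  have "(\<Sum>p\<in>UNIV. f p) = (\<Sum>i\<in>UNIV. \<Sum>j\<in>UNIV. f (i, j))"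
    by (simp add: sum.cartesian_product)
  then show ?thesis by (simp add: sum_2 add.assoc)
qed

text \<open>The mixed-product rule reduces products of spin matrices to the 2 by 2 table
  \<open>pauli_mult\<close>.\<close>

lemma kronecker_mult: "kronecker A B ** kronecker C D = kronecker (A ** C) (B ** D)"
proof -
  have "(kronecker A B ** kronecker C D) $ p $ q = kronecker (A ** C) (B ** D) $ p $ q" for p q
    by (simp add: kronecker_def matrix_matrix_mult_def sum_prod_2 sum_2 algebra_simps)
  then show ?thesis by (simp add: vec_eq_iff)
qed

lemma kronecker_component: "kronecker A B $ p $ q = A $ fst p $ fst q * B $ snd p $ snd q"
  by (simp add: kronecker_def)

text \<open>The unit of the tensor product is the product of the units; this gives
  \<open>mat c\<close> the same entry form as \<open>kronecker_component\<close>.\<close>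

lemma mat_prod_component:
  "(mat c :: spin_matrix) $ p $ q = c * mat 1 $ fst p $ fst q * mat 1 $ snd p $ snd q"
  by (simp add: mat_def prod_eq_iff)

lemma pauli_mult:
  "pauli $ 1 ** pauli $ 1 = mat 1" "pauli $ 2 ** pauli $ 2 = mat 1" "pauli $ 3 ** pauli $ 3 = mat 1"
  "pauli $ 1 ** pauli $ 2 = mat \<i> ** pauli $ 3" "pauli $ 2 ** pauli $ 1 = mat (- \<i>) ** pauli $ 3"
  "pauli $ 2 ** pauli $ 3 = mat \<i> ** pauli $ 1" "pauli $ 3 ** pauli $ 2 = mat (- \<i>) ** pauli $ 1"
  "pauli $ 3 ** pauli $ 1 = mat \<i> ** pauli $ 2" "pauli $ 1 ** pauli $ 3 = mat (- \<i>) ** pauli $ 2"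
  by (simp_all add: pauli_def vec_eq_iff forall_2 matrix_matrix_mult_def sum_2 mat_def)

text \<open>Matrix identities are decided in two stages: this set expands both sides into
  combinations of Kronecker products, and \<open>spin_matrix_component_simps\<close> then compares
  entries, with the Pauli entries left as symbols.\<close>

lemmas spin_matrix_simps = matrix_commutator_def total_spin_def spin_coupling_def spin_cross_def
  spin1_def spin2_def along_def sum_3 matrix_add_ldistrib matrix_add_rdistrib matrix_sub_ldistrib
  matrix_sub_rdistrib matrix_mult_scaleR_left matrix_mult_scaleR_right kronecker_mult pauli_mult

lemmas spin_matrix_component_simps = vec_eq_iff mat_mult_component kronecker_component mat_prod_component

text \<open>With \<open>A\<close> fixed, linearity in \<open>n\<close> reduces all derivatives of
  (n, A) to those of n.\<close>

lemma bounded_linear_along: "bounded_linear (\<lambda>n. along n A)"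
  unfolding along_def
  by (intro bounded_linear_sum bounded_linear_compose[OF bounded_linear_scaleR_left bounded_linear_vec_nth])

lemma smooth_along: "smooth f \<Longrightarrow> smooth (\<lambda>x. along (f x) A)"
  by (rule smooth_bounded_linear[OF bounded_linear_along])

lemma partial_along:
  "f differentiable at x \<Longrightarrow> partial k (\<lambda>x. along (f x) A) x = along (partial k f x) A"
  by (rule partial_bounded_linear[OF bounded_linear_along])

lemmas along_linear = bounded_linear_along[THEN bounded_linear.linear]
lemmas along_scaleR = along_linear[THEN linear_scale]
lemmas along_diff = along_linear[THEN linear_diff]
lemmas along_minus = along_linear[THEN linear_neg]
lemmas along_sum = along_linear[THEN linear_sum]

lemma along_axis: "along (axis j 1) A = A j"
  by (simp add: along_def axis_def if_distrib[where f = "\<lambda>c. c *\<^sub>R _"] cong: if_cong)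

lemma matrix_commutator_along:
  "matrix_commutator A (along n B) = along n (\<lambda>k. matrix_commutator A (B k))"
  by (simp add: matrix_commutator_def along_def sum_3 matrix_add_ldistrib matrix_add_rdistrib
      matrix_mult_scaleR_right matrix_mult_scaleR_left scaleR_diff_right)

text \<open>The simplifier evaluates \<open>2 + 2\<close> and \<open>3 + 2\<close> in the index type to numerals outside \<open>{1, 2, 3}\<close>.\<close>

lemma numeral_3_mod [simp]: "(4::3) = 1" "(5::3) = 2"
  by simp_all

section \<open>The given operators as matrix fields\<close>

lemma sigma_field_op:
  "sigma1 k = field_op (\<lambda>_. spin1 k)" "sigma2 k = field_op (\<lambda>_. spin2 k)"
  by (simp_all add: fun_eq_iff sigma1_def sigma2_def matrix_op_def field_op_def spin1_def spin2_def)

lemma op_K_field_op: "op_K = field_op (\<lambda>_. spin_coupling)"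
  unfolding op_K_def op_inner_def sum_3 sigma_field_op field_op_comp field_op_add
  by (simp add: spin_coupling_def sum_3)

text \<open>Positions act as real scalars, so they pass through constant matrices. Both orders
  occur: \<open>Y5\<close> has the position first, \<open>Y6\<close> and \<open>Y7\<close> have it
  last.\<close>

lemma inv_radius_field_op:
  "inv_radius \<circ> ((field_op (\<lambda>_. A 1) \<circ> position 1) + (field_op (\<lambda>_. A 2) \<circ> position 2)
     + (field_op (\<lambda>_. A 3) \<circ> position 3)) = field_op (\<lambda>x. along (sgn x) A)"
  "inv_radius \<circ> ((position 1 \<circ> field_op (\<lambda>_. A 1)) + (position 2 \<circ> field_op (\<lambda>_. A 2))
     + (position 3 \<circ> field_op (\<lambda>_. A 3))) = field_op (\<lambda>x. along (sgn x) A)"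
  by (simp_all add: fun_eq_iff inv_radius_def position_def mult_op_def field_op_def along_def sum_3
      of_real_vector_smult matrix_vector_mult_add_rdistrib matrix_vector_mult_scaleR_right
      scaleR_matrix_mult_vector sgn_div_norm scaleR_right_distrib divide_inverse mult.commute
      del: of_real_divide of_real_mult of_real_inverse flip: of_real_divide)

lemma Y_field_op:
  "Y5 = field_op (\<lambda>x. along (sgn x) spin_cross)"
  "Y6 = field_op (\<lambda>x. along (sgn x) spin1)"
  "Y7 = field_op (\<lambda>x. along (sgn x) (spin2 - spin1))"
  "inv_radius \<circ> op_inner (sigma1 + sigma2) position = field_op (\<lambda>x. along (sgn x) total_spin)"
  "inv_radius \<circ> op_inner spin position = field_op (\<lambda>x. along (sgn x) (\<lambda>k. mat (1/2) ** total_spin k))"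
proof -
  have *: "sigma2 - sigma1 = (\<lambda>k. field_op (\<lambda>_. (spin2 - spin1) k))"
    "sigma1 + sigma2 = (\<lambda>k. field_op (\<lambda>_. total_spin k))"
    "spin = (\<lambda>k. field_op (\<lambda>_. mat (1/2) ** total_spin k))"
    "op_cross sigma1 sigma2 = (\<lambda>k. field_op (\<lambda>_. spin_cross k))"
    by (rule ext, simp add: sigma_field_op field_op_add field_op_diff total_spin_def spin_def
        scale_field_op spin_cross_def op_cross_def field_op_comp)+
  show "Y5 = field_op (\<lambda>x. along (sgn x) spin_cross)"
    unfolding Y5_def op_inner_def sum_3 * by (rule inv_radius_field_op)
  show "Y6 = field_op (\<lambda>x. along (sgn x) spin1)"
    unfolding Y6_def op_inner_def sum_3 sigma_field_op by (rule inv_radius_field_op)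
  show "Y7 = field_op (\<lambda>x. along (sgn x) (spin2 - spin1))"
    unfolding Y7_def op_inner_def sum_3 * by (rule inv_radius_field_op)
  show "inv_radius \<circ> op_inner (sigma1 + sigma2) position = field_op (\<lambda>x. along (sgn x) total_spin)"
    unfolding op_inner_def sum_3 * by (rule inv_radius_field_op)
  show "inv_radius \<circ> op_inner spin position
      = field_op (\<lambda>x. along (sgn x) (\<lambda>k. mat (1/2) ** total_spin k))"
    unfolding op_inner_def sum_3 * by (rule inv_radius_field_op)
qed

text \<open>Only partial derivatives of the argument remain here, so the product rules can be
  inserted when the argument is \<open>field_op M \<psi>\<close>.\<close>

lemma hamiltonian_apply:
  "hamiltonian hbar V \<psi> x =
     - (of_real (hbar\<^sup>2 / 2)) *s (\<Sum>j\<in>UNIV. partial j (partial j \<psi>) x) + of_real (V (norm x)) *s \<psi> x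
     + (of_real (hbar / (2 * (norm x)\<^sup>2)) * (- \<i> * of_real hbar)) *s
         (\<Sum>k\<in>UNIV. total_spin k *v
           (of_real (x $ (k + 1)) *s partial (k + 2) \<psi> x - of_real (x $ (k + 2)) *s partial (k + 1) \<psi> x))
     + of_real (hbar\<^sup>2 / (4 * (norm x)\<^sup>2)) *s (spin_coupling *v \<psi> x)"
  unfolding hamiltonian_def op_K_def[symmetric] op_K_field_op
  by (simp add: mult_op_def field_op_def laplacian_def op_inner_def sum_3 angular_momentum_def
      op_cross_def position_def momentum_def vec_eq_iff vector_scalar_commute sigma_field_op
      total_spin_def matrix_vector_mult_add_rdistrib algebra_simps)

section \<open>Commutation with the Hamiltonian\<close>

text \<open>
  Multiplied by \<open>- hbar\<^sup>2 / (2 r\<^sup>2)\<close> and \<open>- hbar\<^sup>2 / (4 r\<^sup>2)\<close> respectively, the differences of the two sides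
  of the hypotheses are the coefficients of \<open>\<partial>\<^sub>j\<close> and of the identity in the first order operator \<open>[H, M]\<close>.
\<close>

lemma integral_of_motion_field_op:
  fixes M :: "real^3 \<Rightarrow> spin_matrix"
  assumes M: "smooth M"
    and first_order: "\<And>x j. x \<noteq> 0 \<Longrightarrow> (2 * (norm x)\<^sup>2) *\<^sub>R partial j M x =
      mat (- \<i>) ** (x $ (j + 2) *\<^sub>R matrix_commutator (total_spin (j + 1)) (M x)
        - x $ (j + 1) *\<^sub>R matrix_commutator (total_spin (j + 2)) (M x))"
    and zeroth_order: "\<And>x. x \<noteq> 0 \<Longrightarrow> (2 * (norm x)\<^sup>2) *\<^sub>R (\<Sum>j\<in>UNIV. partial j (partial j M) x)
      + mat (2 * \<i>) ** (\<Sum>k\<in>UNIV. total_spin k **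
          (x $ (k + 1) *\<^sub>R partial (k + 2) M x - x $ (k + 2) *\<^sub>R partial (k + 1) M x))
      = matrix_commutator spin_coupling (M x)"
  shows "integral_of_motion (hamiltonian hbar V) (field_op M)"
proof -
  have "commutator (hamiltonian hbar V) (field_op M) \<psi> x = 0"
    if \<psi>: "smooth \<psi>" and x: "x \<noteq> 0" for \<psi> x
  proof -
    \<comment> \<open>The factor 1/r^2 becomes an atom, and the hypotheses are solved for the
      derivatives of \<open>M\<close>; the final identity is then polynomial.\<close>
    define w :: complex where "w = inverse (of_real ((norm x)\<^sup>2))"
    let ?M = "M x" and ?D = "\<lambda>j. partial j M x" and ?T = total_spin and ?K = spin_coupling
    let ?c = "\<lambda>k. complex_of_real (x $ k)"
    have w: "2 * of_real ((norm x)\<^sup>2) * a = b \<longleftrightarrow> a = w / 2 * b" for a b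
      using x by (auto simp: w_def field_simps)
    have mv: "(c *\<^sub>R A) *v v = of_real c *s (A *v v)" for c and A :: spin_matrix and v
      by (simp add: scaleR_matrix_mult_vector of_real_vector_smult)
    note push = matrix_vector_mult_add_rdistrib matrix_vector_mult_diff_rdistrib
      matrix_vector_mul_assoc[symmetric] mat_vector_mult mv matrix_commutator_def
      matrix_vector_right_distrib matrix_vector_mult_diff_distrib vector_scalar_commute
    have D: "(?D j *v v) $ i = w / 2 * (- \<i> *
        (?c (j + 2) * ((?T (j + 1) *v (?M *v v)) $ i - (?M *v (?T (j + 1) *v v)) $ i)
          - ?c (j + 1) * ((?T (j + 2) *v (?M *v v)) $ i - (?M *v (?T (j + 2) *v v)) $ i)))" for j v i
      using arg_cong[OF first_order[OF x, of j], of "\<lambda>A. (A *v v) $ i"] unfolding w[symmetric]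
      by (simp add: push algebra_simps)
    have DD: "((\<Sum>j\<in>UNIV. partial j (partial j M) x) *v v) $ i =
        w / 2 * ((?K *v (?M *v v)) $ i - (?M *v (?K *v v)) $ i - 2 * \<i> * (\<Sum>k\<in>UNIV.
           ?c (k + 1) * (?T k *v (?D (k + 2) *v v)) $ i - ?c (k + 2) * (?T k *v (?D (k + 1) *v v)) $ i))"
      for v i
      using arg_cong[OF zeroth_order[OF x], of "\<lambda>A. (A *v v) $ i"] unfolding w[symmetric]
      by (simp add: push sum_3 algebra_simps)
    \<comment> \<open>Expanding sums separates the three second derivatives, so the formula for
      their sum is solved for the first of them to serve as a rewrite rule.\<close>
    have DD': "(partial 1 (partial 1 M) x *v v) $ i =
        w / 2 * ((?K *v (?M *v v)) $ i - (?M *v (?K *v v)) $ i - 2 * \<i> * (\<Sum>k\<in>UNIV.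
           ?c (k + 1) * (?T k *v (?D (k + 2) *v v)) $ i - ?c (k + 2) * (?T k *v (?D (k + 1) *v v)) $ i))
        - (partial 2 (partial 2 M) x *v v) $ i - (partial 3 (partial 3 M) x *v v) $ i"
      for v i
      using DD[of v i] by (simp add: sum_3 matrix_vector_mult_add_rdistrib eq_diff_eq add_ac)
    have h: "of_real (hbar / (2 * (norm x)\<^sup>2)) = of_real hbar * w / 2"
      "of_real (hbar\<^sup>2 / (4 * (norm x)\<^sup>2)) = (of_real hbar)\<^sup>2 * w / 4"
      by (simp_all add: w_def field_simps)
    show ?thesis
      \<comment> \<open>The potential and the second derivatives of \<psi> cancel; \<open>D\<close>
        and \<open>DD'\<close> then eliminate derivatives of \<open>M\<close>.\<close>
      unfolding commutator_def fun_diff_def o_apply field_op_def[of M "hamiltonian hbar V \<psi>"]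
        hamiltonian_apply h partial_field_op[OF M \<psi> x] partial_partial_field_op[OF M \<psi> x]
      by (simp add: field_op_def sum_3 vec_eq_iff push scaleR_conv_of_real D DD' algebra_simps power2_eq_square)
  qed
  then show ?thesis
    by (auto simp: integral_of_motion_def op_eq_def smooth_operator_field_op M)
qed

text \<open>The field is constant, so both conditions reduce to commutators: the scalar product of
  the spins commutes with the total spin, and with itself.\<close>

lemma integral_of_motion_op_K: "integral_of_motion (hamiltonian hbar V) op_K"
  unfolding op_K_field_op
proof (rule integral_of_motion_field_op)
  have comm: "matrix_commutator (total_spin k) spin_coupling = 0" for k
    using exhaust_3[of k]
    by (elim disjE; simp add: spin_matrix_simps; simp add: spin_matrix_component_simps algebra_simps)
  have z: "partial k (\<lambda>_. c) = (\<lambda>_. 0)" for k and c :: spin_matrix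
    by (simp add: fun_eq_iff partial_const)
  have z': "A ** 0 = 0" for A :: spin_matrix
    by (simp add: vec_eq_iff matrix_matrix_mult_def)
  show "smooth (\<lambda>_. spin_coupling)"
    by (rule smooth_const)
  fix x :: "real^3"
  show "(2 * (norm x)\<^sup>2) *\<^sub>R partial j (\<lambda>_. spin_coupling) x =
      mat (- \<i>) ** (x $ (j + 2) *\<^sub>R matrix_commutator (total_spin (j + 1)) spin_coupling
        - x $ (j + 1) *\<^sub>R matrix_commutator (total_spin (j + 2)) spin_coupling)" for j
    by (simp add: z comm z')
  show "(2 * (norm x)\<^sup>2) *\<^sub>R (\<Sum>j\<in>UNIV. partial j (partial j (\<lambda>_. spin_coupling)) x)
      + mat (2 * \<i>) ** (\<Sum>k\<in>UNIV. total_spin k **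
          (x $ (k + 1) *\<^sub>R partial (k + 2) (\<lambda>_. spin_coupling) x
            - x $ (k + 2) *\<^sub>R partial (k + 1) (\<lambda>_. spin_coupling) x))
      = matrix_commutator spin_coupling spin_coupling"
    by (simp add: z z' matrix_commutator_def)
qed

text \<open>
  The first three conditions say that \<open>A\<close> is a vector for the rotations generated by the total spin:
  they give the first order part of the commutator of the Hamiltonian with \<open>(x, A) / r\<close>. The last one
  gives its zeroth order part.
\<close>

definition conserved_vector :: "(3 \<Rightarrow> spin_matrix) \<Rightarrow> bool" where
  "conserved_vector A \<longleftrightarrow> (\<forall>k.
     matrix_commutator (total_spin k) (A k) = 0 \<and>
     matrix_commutator (total_spin k) (A (k + 1)) = mat (2 * \<i>) ** A (k + 2) \<and>
     matrix_commutator (total_spin k) (A (k + 2)) = mat (- 2 * \<i>) ** A (k + 1) \<and>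
     matrix_commutator spin_coupling (A (k + 2)) =
       mat (2 * \<i>) ** (total_spin (k + 1) ** A k - total_spin k ** A (k + 1)) - 4 *\<^sub>R A (k + 2))"

text \<open>The commutators of the total spin with (n, A) are 2i (n x A), so the first order
  condition reads -n x (n x A) = A - n (n, A), true for unit n. In the zeroth order one the radial
  terms of the derivatives cancel, and comparing coefficients of n leaves the last clause of
  \<open>conserved_vector\<close>.\<close>

lemma integral_of_motion_along:
  assumes "conserved_vector A"
  shows "integral_of_motion (hamiltonian hbar V) (field_op (\<lambda>x. along (sgn x) A))"
proof (rule integral_of_motion_field_op)
  show "smooth (\<lambda>x. along (sgn x) A)"
    by (intro smooth_along smooth_sgn)
  fix x :: "real^3" assume x: "x \<noteq> 0"
  define r n where "r = norm x" and "n = sgn x"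
  have r: "r \<noteq> 0" "x = r *\<^sub>R n"
    using x by (simp_all add: r_def n_def sgn_conv_norm)
  have unit: "(n $ 1)\<^sup>2 + (n $ 2)\<^sup>2 + (n $ 3)\<^sup>2 = 1"
    using sum_sgn_squares[OF x] by (simp add: n_def sum_3)
  have D: "partial j (\<lambda>x. along (sgn x) A) x = (1 / r) *\<^sub>R (A j - n $ j *\<^sub>R along n A)" for j
    using partial_along[of sgn x j A] x
    by (simp add: smooth_differentiable smooth_sgn partial_sgn along_scaleR along_diff along_axis r_def n_def)
  have DD: "(\<Sum>j\<in>UNIV. partial j (partial j (\<lambda>x. along (sgn x) A)) x) = - (2 / r\<^sup>2) *\<^sub>R along n A"
  proof -
    have "partial j (partial j (\<lambda>x. along (sgn x) A)) x = along (partial j (partial j sgn) x) A" for j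
    proof -
      have "partial j (partial j (\<lambda>x. along (sgn x) A)) x = partial j (\<lambda>x. along (partial j sgn x) A) x"
        using x by (intro partial_cong partial_along smooth_differentiable smooth_partial smooth_along smooth_sgn)
      also have "\<dots> = along (partial j (partial j sgn) x) A"
        using x by (intro partial_along smooth_differentiable smooth_partial smooth_sgn)
      finally show ?thesis .
    qed
    then show ?thesis
      using x by (simp add: laplacian_sgn along_scaleR along_minus r_def n_def flip: along_sum)
  qed
  show "(2 * (norm x)\<^sup>2) *\<^sub>R partial j (\<lambda>x. along (sgn x) A) x =
      mat (- \<i>) ** (x $ (j + 2) *\<^sub>R matrix_commutator (total_spin (j + 1)) (along (sgn x) A)
        - x $ (j + 1) *\<^sub>R matrix_commutator (total_spin (j + 2)) (along (sgn x) A))" for j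
  proof -
    note C = assms[unfolded conserved_vector_def forall_3, simplified]
    \<comment> \<open>The normalisation of n as a rewrite rule that eliminates the square of
      \<open>n $ 1\<close>, nested to the right to match the normal form of
      \<open>algebra_simps\<close>.\<close>
    have u: "complex_of_real (n $ 1) * (complex_of_real (n $ 1) * a)
        = a - complex_of_real (n $ 2) * (complex_of_real (n $ 2) * a)
          - complex_of_real (n $ 3) * (complex_of_real (n $ 3) * a)" for a
      using arg_cong[OF unit, of "\<lambda>t. complex_of_real t * a"]
      by (simp add: power2_eq_square algebra_simps)
    show ?thesis
      unfolding D r_def[symmetric] n_def[symmetric] matrix_commutator_along
      unfolding r(2)
      using exhaust_3[of j] r(1)
      unfolding vec_eq_iff
      by (elim disjE; simp add: along_def sum_3 C mat_mult_component;
          simp add: scaleR_conv_of_real power2_eq_square algebra_simps u)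
  qed
  show "(2 * (norm x)\<^sup>2) *\<^sub>R (\<Sum>j\<in>UNIV. partial j (partial j (\<lambda>x. along (sgn x) A)) x) +
      mat (2 * \<i>) ** (\<Sum>k\<in>UNIV. total_spin k **
          (x $ (k + 1) *\<^sub>R partial (k + 2) (\<lambda>x. along (sgn x) A) x
            - x $ (k + 2) *\<^sub>R partial (k + 1) (\<lambda>x. along (sgn x) A) x))
      = matrix_commutator spin_coupling (along (sgn x) A)"
  proof -
    note C = assms[unfolded conserved_vector_def forall_3, simplified]
    show ?thesis
      unfolding DD unfolding D r_def[symmetric] n_def[symmetric] matrix_commutator_along
      unfolding r(2)
      unfolding vec_eq_iff using r(1)
      by (simp add: along_def sum_3 C mat_mult_component matrix_mult_scaleR_right matrix_sub_ldistrib
            matrix_add_ldistrib scaleR_diff_right scaleR_add_right)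
         (simp add: scaleR_conv_of_real power2_eq_square algebra_simps)
  qed
qed

text \<open>Rotating both spins rotates each Pauli vector, hence also their difference and cross
  product; the last clause follows from the same multiplication table.\<close>

lemma conserved_vector_spins:
  "conserved_vector spin1" "conserved_vector (spin2 - spin1)" "conserved_vector spin_cross"
  unfolding conserved_vector_def forall_3
  by (simp add: spin_matrix_simps;
      simp add: spin_matrix_component_simps algebra_simps scaleR_conv_of_real)+

section \<open>The symmetry algebra\<close>

lemma spin_coupling_commutators:
  "matrix_commutator spin_coupling (along n spin1) = mat (2 * \<i>) ** along n spin_cross"
  "matrix_commutator spin_coupling (along n spin_cross) = mat (4 * \<i>) ** along n (spin2 - spin1)"
  "matrix_commutator spin_coupling (along n (spin2 - spin1)) = mat (- 4 * \<i>) ** along n spin_cross"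
  "matrix_commutator (along n spin1) (along n (spin2 - spin1)) = 0"
  by (simp add: spin_matrix_simps; simp add: spin_matrix_component_simps;
      simp add: scaleR_conv_of_real algebra_simps)+

text \<open>For unit n both (n, sigma_1 x sigma_2)^2 and (n, sigma_2 - sigma_1)^2 equal 2 - 2 (n,
  sigma_1)(n, sigma_2). The bracket on the right is thus the coupling of the spin components
  orthogonal to n.\<close>

lemma along_commutators:
  assumes "(\<Sum>k\<in>UNIV. (n $ k)\<^sup>2) = 1"
  shows "matrix_commutator (along n spin1) (along n spin_cross) =
      mat (2 * \<i>) ** (spin_coupling - mat 1 + mat (1 / 2) ** (along n spin_cross ** along n spin_cross))"
    "matrix_commutator (along n (spin2 - spin1)) (along n spin_cross) =
      mat (- 4 * \<i>) ** (spin_coupling - mat 1 + mat (1 / 2) ** (along n spin_cross ** along n spin_cross))"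
    "along n spin1 ** along n spin1 = mat 1"
    "along n (spin2 - spin1) ** along n (spin2 - spin1) = along n spin_cross ** along n spin_cross"
proof -
  have u: "complex_of_real (n $ 1) * (complex_of_real (n $ 1) * a)
        = a - complex_of_real (n $ 2) * (complex_of_real (n $ 2) * a)
          - complex_of_real (n $ 3) * (complex_of_real (n $ 3) * a)" for a
    using arg_cong[OF assms, of "\<lambda>t. complex_of_real t * a"]
    by (simp add: sum_3 power2_eq_square algebra_simps)
  show "matrix_commutator (along n spin1) (along n spin_cross) =
      mat (2 * \<i>) ** (spin_coupling - mat 1 + mat (1 / 2) ** (along n spin_cross ** along n spin_cross))"
    "matrix_commutator (along n (spin2 - spin1)) (along n spin_cross) =
      mat (- 4 * \<i>) ** (spin_coupling - mat 1 + mat (1 / 2) ** (along n spin_cross ** along n spin_cross))"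
    "along n spin1 ** along n spin1 = mat 1"
    "along n (spin2 - spin1) ** along n (spin2 - spin1) = along n spin_cross ** along n spin_cross"
    by (simp add: spin_matrix_simps; simp add: spin_matrix_component_simps;
      simp add: scaleR_conv_of_real algebra_simps u)+
qed

lemma total_spin_decomposition:
  "along n (spin2 - spin1) + mat 2 ** along n spin1 = along n total_spin"
  "along n total_spin = mat 2 ** along n (\<lambda>k. mat (1 / 2) ** total_spin k)"
  by (simp add: spin_matrix_simps; simp add: spin_matrix_component_simps;
      simp add: scaleR_conv_of_real algebra_simps)+

text \<open>The total spin along n generates rotations of both spins about n, which fix the coupling
  and all components along n.\<close>

lemma along_total_spin_central:
  "matrix_commutator (along n total_spin) spin_coupling = 0"
  "matrix_commutator (along n total_spin) (along n spin_cross) = 0"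
  "matrix_commutator (along n total_spin) (along n spin1) = 0"
  "matrix_commutator (along n total_spin) (along n (spin2 - spin1)) = 0"
  by (simp add: spin_matrix_simps; simp add: spin_matrix_component_simps;
      simp add: scaleR_conv_of_real algebra_simps)+

section \<open>Commutators as polynomials in the generators\<close>

lemma commutator_swap: "commutator A B \<doteq> P \<Longrightarrow> commutator B A \<doteq> (- 1) \<cdot>\<^sub>o P"
  by (auto simp: op_eq_def commutator_def mult_op_def algebra_simps)

lemma polynomials_in_scale: "A \<in> polynomials_in G \<Longrightarrow> c \<cdot>\<^sub>o A \<in> polynomials_in G"
  using polynomials_in.comp[OF polynomials_in.const] by fastforce

theorem proposition2:
  fixes hbar :: real and V\<^sub>0 :: "real \<Rightarrow> real"
  assumes "hbar > 0"
  shows "integral_of_motion (hamiltonian hbar V\<^sub>0) op_K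
       \<and> integral_of_motion (hamiltonian hbar V\<^sub>0) Y5
       \<and> integral_of_motion (hamiltonian hbar V\<^sub>0) Y6
       \<and> integral_of_motion (hamiltonian hbar V\<^sub>0) Y7
       \<and> generates_polynomial_symmetry_algebra (hamiltonian hbar V\<^sub>0) {op_K, Y5, Y6, Y7}
       \<and> commutator op_K Y6 \<doteq> (2 * \<i>) \<cdot>\<^sub>o Y5
       \<and> commutator op_K Y5 \<doteq> (4 * \<i>) \<cdot>\<^sub>o Y7
       \<and> commutator op_K Y7 \<doteq> (- 4 * \<i>) \<cdot>\<^sub>o Y5
       \<and> commutator Y6 Y7 \<doteq> 0
       \<and> commutator Y6 Y5 \<doteq> (2 * \<i>) \<cdot>\<^sub>o (op_K - id + (1 / 2) \<cdot>\<^sub>o (Y5 \<circ> Y5))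
       \<and> commutator Y7 Y5 \<doteq> (- 4 * \<i>) \<cdot>\<^sub>o (op_K - id + (1 / 2) \<cdot>\<^sub>o (Y5 \<circ> Y5))
       \<and> Y6 \<circ> Y6 \<doteq> id
       \<and> Y7 \<circ> Y7 \<doteq> Y5 \<circ> Y5
       \<and> Y7 + 2 \<cdot>\<^sub>o Y6 \<doteq> inv_radius \<circ> op_inner (sigma1 + sigma2) position
       \<and> inv_radius \<circ> op_inner (sigma1 + sigma2) position
           \<doteq> 2 \<cdot>\<^sub>o (inv_radius \<circ> op_inner spin position)
       \<and> commutator (Y7 + 2 \<cdot>\<^sub>o Y6) op_K \<doteq> 0
       \<and> commutator (Y7 + 2 \<cdot>\<^sub>o Y6) Y5 \<doteq> 0
       \<and> commutator (Y7 + 2 \<cdot>\<^sub>o Y6) Y6 \<doteq> 0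
       \<and> commutator (Y7 + 2 \<cdot>\<^sub>o Y6) Y7 \<doteq> 0"
proof -
  note field_ops = op_K_field_op Y_field_op id_field_op zero_field_op field_op_comp field_op_add
    field_op_diff scale_field_op commutator_field_op
  let ?H = "hamiltonian hbar V\<^sub>0" and ?G = "{op_K, Y5, Y6, Y7}"
  let ?P = "op_K - id + (1 / 2) \<cdot>\<^sub>o (Y5 \<circ> Y5)"
  have motion: "integral_of_motion ?H op_K" "integral_of_motion ?H Y5" "integral_of_motion ?H Y6"
    "integral_of_motion ?H Y7"
    unfolding Y_field_op
    by (rule integral_of_motion_op_K integral_of_motion_along conserved_vector_spins)+
  have relations: "commutator op_K Y6 \<doteq> (2 * \<i>) \<cdot>\<^sub>o Y5" "commutator op_K Y5 \<doteq> (4 * \<i>) \<cdot>\<^sub>o Y7"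
    "commutator op_K Y7 \<doteq> (- 4 * \<i>) \<cdot>\<^sub>o Y5" "commutator Y6 Y7 \<doteq> 0"
    "commutator Y6 Y5 \<doteq> (2 * \<i>) \<cdot>\<^sub>o ?P" "commutator Y7 Y5 \<doteq> (- 4 * \<i>) \<cdot>\<^sub>o ?P"
    unfolding field_ops
    by (intro op_eq_field_op spin_coupling_commutators along_commutators sum_sgn_squares; assumption)+
  have squares: "Y6 \<circ> Y6 \<doteq> id" "Y7 \<circ> Y7 \<doteq> Y5 \<circ> Y5"
    unfolding field_ops by (intro op_eq_field_op along_commutators sum_sgn_squares; assumption)+
  have spin: "Y7 + 2 \<cdot>\<^sub>o Y6 \<doteq> inv_radius \<circ> op_inner (sigma1 + sigma2) position"
    "inv_radius \<circ> op_inner (sigma1 + sigma2) position \<doteq> 2 \<cdot>\<^sub>o (inv_radius \<circ> op_inner spin position)"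
    unfolding field_ops by (intro op_eq_field_op total_spin_decomposition)+
  have central: "commutator (Y7 + 2 \<cdot>\<^sub>o Y6) op_K \<doteq> 0" "commutator (Y7 + 2 \<cdot>\<^sub>o Y6) Y5 \<doteq> 0"
    "commutator (Y7 + 2 \<cdot>\<^sub>o Y6) Y6 \<doteq> 0" "commutator (Y7 + 2 \<cdot>\<^sub>o Y6) Y7 \<doteq> 0"
    \<comment> \<open>The combination is first collected into the single field
      \<open>along (sgn x) total_spin\<close>.\<close>
    unfolding field_ops total_spin_decomposition(1)
    by (intro op_eq_field_op along_total_spin_central)+
  have gens: "op_K \<in> polynomials_in ?G" "Y5 \<in> polynomials_in ?G" "Y7 \<in> polynomials_in ?G"
    by (auto intro: polynomials_in.gen)
  have zero: "0 \<in> polynomials_in ?G"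
  proof -
    have "0 \<cdot>\<^sub>o id = (0 :: operator)" by (simp add: fun_eq_iff mult_op_def)
    then show ?thesis using polynomials_in.const[of 0 ?G] by simp
  qed
  have P: "?P \<in> polynomials_in ?G"
  proof -
    \<comment> \<open>\<open>polynomials_in\<close> has no rule for differences, so the unit is
      added with coefficient -1.\<close>
    have "?P = op_K + (- 1) \<cdot>\<^sub>o id + (1 / 2) \<cdot>\<^sub>o (Y5 \<circ> Y5)"
      by (simp add: fun_eq_iff mult_op_def)
    then show ?thesis
      using gens by (simp only: polynomials_in.add polynomials_in.const polynomials_in_scale polynomials_in.comp)
  qed
  \<comment> \<open>This relation is reflexive and symmetric, so six of the sixteen pairs of
    generators suffice.\<close>
  define R where "R A B \<longleftrightarrow> (\<exists>P\<in>polynomials_in ?G. commutator A B \<doteq> P)" for A B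
  have swap: "R B A" if "R A B" for A B
    using that commutator_swap polynomials_in_scale unfolding R_def by blast
  have self: "R A A" for A
    unfolding R_def by (rule bexI[OF _ zero]) (simp add: op_eq_def commutator_def)
  have "R op_K Y6" "R op_K Y5" "R op_K Y7" "R Y6 Y7" "R Y6 Y5" "R Y7 Y5"
    unfolding R_def
    by (rule bexI, rule relations, intro zero polynomials_in_scale gens P)+
  then have "R A B" if "A \<in> ?G" "B \<in> ?G" for A B
    using that self swap by blast
  then have "generates_polynomial_symmetry_algebra ?H ?G"
    using motion by (auto simp: generates_polynomial_symmetry_algebra_def R_def)
  then show ?thesis
    using motion relations squares spin central by blast
qed

end
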